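(* Let $m\ge1$. With $\mu_{m\,t}=2\cos\left(\frac{2\pi t}{2m+1}\right)-2$ ($1\le t\le m$), the roots of $P_m(x)=0$, and $\phi_{m\,t}=2\cos\left(\frac{2\pi t}{2m+1}\right)$, for all $r\in\mathbb{Z}$ we have $$\mathscr{F}_r^{(m,m)}=-\mathscr{G}_r^{(m,m)}=-\sum_{k=1}^m\frac{2m+1}{\mu_{m\,k}^{\,r}\prod_{j\ne k}(\mu_{m\,k}-\mu_{m\,j})}$$ $$=-(2m+1)\sum_{k=1}^m\left(2\cos\tfrac{2\pi k}{2m+1}-2\right)^{-r}\prod_{j\neq k}\left(2\cos\tfrac{2\pi k}{2m+1}-2\cos\tfrac{2\pi j}{2m+1}\right)^{-1},$$ $$\mathscr{F}_r^{(m,1)}=\mu_{m\,1}^{1-r}+\dots+\mu_{m\,m}^{1-r}=\sum_{k=1}^m\left(2\cos\tfrac{2\pi k}{2m+1}-2\right)^{1-r},$$ and for $1\le j\le m$ $$\mathscr{F}_r^{(m,j)}=\sum_{t=1}^m\mu_{m\,t}^{1-r}P_{j-1}(\mu_{m\,t})=\sum_{t=1}^m\mu_{m\,t}^{1-r}\prod_{k=1}^{j-1}(\mu_{m\,t}-\mu_{(j-1)\,k})=\sum_{t=1}^m\mu_{m\,t}^{1-r}\prod_{k=1}^{j-1}(\phi_{m\,t}-\phi_{(j-1)\,k})$$ $$=\sum_{t=1}^m\mu_{m\,t}^{1-r}S_{2j-2}\left(2\cos\tfrac{\pi t}{2m+1}\right)=(-1)^{r-1}\sum_{t=1}^m\frac{2\sin\left(\frac{(2j-1)\pi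 t}{2m+1}\right)}{\left(2\sin\left(\frac{\pi t}{2m+1}\right)\right)^{2r-1}}=\sum_{t=1}^m\mu_{m\,t}^{1-r}V_{j-1}(\phi_{m\,t}),$$ $$\mathscr{G}_r^{(m,j)}=\sum_{t=1}^m\mu_{m\,t}^{1-r}Q_j(\mu_{m\,t})=\sum_{t=1}^m\mu_{m\,t}^{1-r}\prod_{k=1}^{j}(\mu_{m\,t}-\nu_{j\,k})=\sum_{t=1}^m\mu_{m\,t}^{1-r}\,\mathcal{C}_{2j}\left(2\cos\tfrac{\pi t}{2m+1}\right)$$ $$=(-1)^{r-1}\sum_{t=1}^m\frac{2\cos\left(\frac{2j\pi t}{2m+1}\right)}{\left(2\sin\left(\frac{\pi t}{2m+1}\right)\right)^{2r-2}}.$$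
   Context: For an integer $m\ge0$: $P_m(x)=\sum_{k=0}^{m}\frac{2m+1}{2k+1}\binom{m+k}{2k}x^{k}$, $Q_m(x)=2+\sum_{k=1}^{m}\frac{m}{k}\binom{m+k-1}{2k-1}x^k$, $V_m(x)=\sum_{k=0}^m(-1)^{k+\lfloor (m+k)/2\rfloor}\binom{\lfloor (m+k)/2\rfloor}{k}x^{k}=P_m(x-2)$. For $j\ge1$, $\nu_{j\,1},\dots,\nu_{j\,j}$ are the roots of $Q_j$. $\mathcal{C}_n(x)=2T_n(x/2)$ and $S_n(x)=U_n(x/2)$ with $T_n,U_n$ the Chebyshev polynomials of the first and second kinds. Rational interlacing Fibonacci sequences of dimension $m\ge1$. Let $h_k=\frac1{2k+1}\binom{m+k}{2k}$ and let $R_m$ be the $m\times m$ matrix whose first column is $(-h_1,-h_2,\dots,-h_m)^T$, whose entries $(i,i+1)$, $1\le i\le m-1$, equal $1$, and whose other entries are $0$ (it is invertible). Let $B_{\rm odd}$, $B_{\rm even}$ be the $m\times m$ matrices with $(i,j)$ entries $(-1)^{i+j-1}\binom{2j-1}{j-i}$ and $(-1)^{i+j}\binom{2j}{j-i}$ respectively (binomial coefficients with negative lower entry are $0$). For $r\in\mathbb{Z}$ and $1\le j\le m$, $\mathscr{F}_r^{(m,j)}$ (resp. $\mathscr{G}_r^{(m,j)}$) is the $(j,1)$ entry of $(2m+1)B_{\rm odd}R_m^{r}$ (resp. $(2m+1)B_{\rm even}R_m^{r}$). *)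

theory Defs
  imports
    Complex_Main
    "HOL-Computational_Algebra.Polynomial"
    "Jordan_Normal_Form.Matrix"
begin

definition P_poly :: "nat \<Rightarrow> 'a::field_char_0 poly" where
  "P_poly m = (\<Sum>k\<le>m. monom (of_nat (2*m+1) / of_nat (2*k+1) * of_nat ((m+k) choose (2*k))) k)"

definition Q_poly :: "nat \<Rightarrow> 'a::field_char_0 poly" where
  "Q_poly m = [:2:] + (\<Sum>k=1..m. monom (of_nat m / of_nat k * of_nat ((m+k-1) choose (2*k-1))) k)"

definition V_poly :: "nat \<Rightarrow> 'a::field_char_0 poly" where
  "V_poly m = (\<Sum>k\<le>m. monom ((-1) ^ (k + (m+k) div 2) * of_nat (((m+k) div 2) choose k)) k)"

fun cheb_T :: "nat \<Rightarrow> real poly" where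
  "cheb_T 0 = 1"
| "cheb_T (Suc 0) = [:0, 1:]"
| "cheb_T (Suc (Suc n)) = [:0, 2:] * cheb_T (Suc n) - cheb_T n"

fun cheb_U :: "nat \<Rightarrow> real poly" where
  "cheb_U 0 = 1"
| "cheb_U (Suc 0) = [:0, 2:]"
| "cheb_U (Suc (Suc n)) = [:0, 2:] * cheb_U (Suc n) - cheb_U n"

definition C_cheb :: "nat \<Rightarrow> real \<Rightarrow> real" where
  "C_cheb n x = 2 * poly (cheb_T n) (x / 2)"

definition S_cheb :: "nat \<Rightarrow> real \<Rightarrow> real" where
  "S_cheb n x = poly (cheb_U n) (x / 2)"

definition phi :: "nat \<Rightarrow> nat \<Rightarrow> real" where
  "phi m t = 2 * cos (2 * pi * real t / real (2*m+1))"

definition mu :: "nat \<Rightarrow> nat \<Rightarrow> real" where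
  "mu m t = 2 * cos (2 * pi * real t / real (2*m+1)) - 2"

definition h_coeff :: "nat \<Rightarrow> nat \<Rightarrow> real" where
  "h_coeff m k = 1 / real (2*k+1) * real ((m+k) choose (2*k))"

text \<open>Matrix indices start at 0 in the library. The matrices below are therefore written as
  functions of the usual indices starting at 1, shifted by one.\<close>

definition mat1 :: "nat \<Rightarrow> (nat \<Rightarrow> nat \<Rightarrow> real) \<Rightarrow> real mat" where
  "mat1 m f = mat m m (\<lambda>(i, j). f (i + 1) (j + 1))"

definition R_mat :: "nat \<Rightarrow> real mat" where
  "R_mat m = mat1 m (\<lambda>i j. if j = 1 then - h_coeff m i else if j = i + 1 then 1 else 0)"

text \<open>The case distinction gives the value 0 for a negative lower entry of the binomial
  coefficient, where subtraction of natural numbers would truncate.\<close>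

definition B_odd :: "nat \<Rightarrow> real mat" where
  "B_odd m = mat1 m (\<lambda>i j. if i \<le> j then (-1) ^ (i+j-1) * real ((2*j-1) choose (j-i)) else 0)"

definition B_even :: "nat \<Rightarrow> real mat" where
  "B_even m = mat1 m (\<lambda>i j. if i \<le> j then (-1) ^ (i+j) * real ((2*j) choose (j-i)) else 0)"

text \<open>Integer powers of \<open>R_mat m\<close> are taken in the multiplicative monoid of the ring of
  \<open>m \<times> m\<close> matrices; for a negative exponent this is the power of the two-sided inverse.\<close>

definition R_pow :: "nat \<Rightarrow> int \<Rightarrow> real mat" where
  "R_pow m r = R_mat m [^]\<^bsub>ring_mat TYPE(real) m ()\<^esub> r"

definition F_seq :: "nat \<Rightarrow> nat \<Rightarrow> int \<Rightarrow> real" where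
  "F_seq m j r = (real (2*m+1) \<cdot>\<^sub>m (B_odd m * R_pow m r)) $$ (j - 1, 0)"

definition G_seq :: "nat \<Rightarrow> nat \<Rightarrow> int \<Rightarrow> real" where
  "G_seq m j r = (real (2*m+1) \<cdot>\<^sub>m (B_even m * R_pow m r)) $$ (j - 1, 0)"

end

theory Submission
  imports Defs "HOL-Computational_Algebra.Fundamental_Theorem_Algebra"
begin

text \<open>
  Write \<open>\<theta>\<^sub>t = pi t / (2m+1)\<close>, so that \<open>\<mu>\<^sub>t = 2 cos(2\<theta>\<^sub>t) - 2 = -(2 sin \<theta>\<^sub>t)\<^sup>2\<close>. The identity
  \<open>P\<^sub>m(2 cos(2\<theta>) - 2) sin \<theta> = sin((2m+1)\<theta>)\<close> (\<open>poly_P_poly_sin\<close>) shows that the \<open>\<mu>\<^sub>t\<close> are the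
  roots of \<open>P\<^sub>m\<close>.

  The matrix \<open>R\<close> is never diagonalized on the side of column vectors. Its left eigenvectors are
  simple: because \<open>P\<^sub>m(\<mu>\<^sub>t) = 0\<close>, the row \<open>(\<mu>\<^sub>t, \<mu>\<^sub>t\<^sup>2, \<dots>)\<close> satisfies the
  eigenvector equation with eigenvalue \<open>1/\<mu>\<^sub>t\<close> (\<open>R_mat_left_eigen\<close>), hence with
  eigenvalue \<open>\<mu>\<^sub>t^(-r)\<close> for the \<open>r\<close>-th power, negative \<open>r\<close> included. The matrices
  \<open>B_odd\<close> and \<open>B_even\<close> contain the binomial coefficients that expand the powers of
  \<open>-(2 sin \<theta>)\<^sup>2\<close> in multiple angles, so they carry the rows \<open>2 sin((2j-1)\<theta>\<^sub>t)\<close> and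
  \<open>2 cos(2j\<theta>\<^sub>t) - 2\<close>, indexed by \<open>j\<close>, to multiples of these eigenvectors (\<open>B_odd_dual\<close>,
  \<open>B_even_dual\<close>). Applying such a row to the column that defines \<open>F\<close> or \<open>G\<close> therefore
  gives an explicit power of \<open>\<mu>\<^sub>t\<close> (\<open>row_R_pow\<close>). Discrete orthogonality in \<open>t\<close>
  (\<open>sin_orthogonality\<close>, \<open>cos_biorthogonality\<close>) inverts these \<open>m\<close> equations and yields
  \<open>F_seq_trig\<close> and \<open>G_seq_trig\<close>, and most of the other sums only rewrite the summand.

  The forms in \<open>P\<close>, \<open>Q\<close>, \<open>V\<close> and the Chebyshev polynomials express the same sines and
  cosines. The form with \<open>\<Prod>(\<mu>\<^sub>k - \<mu>\<^sub>j)\<close> holds because this product is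
  the derivative of \<open>P\<^sub>m\<close> at \<open>\<mu>\<^sub>k\<close>, which follows by differentiating the sine
  identity (\<open>P_poly_pred_deriv\<close>). Finally \<open>F = -G\<close> at \<open>j = m\<close> because
  \<open>Q\<^sub>m = P\<^sub>m - P\<^bsub>m-1\<^esub>\<close> and \<open>P\<^sub>m\<close> vanishes at the \<open>\<mu>\<^sub>t\<close>.
\<close>

section \<open>The polynomials: recurrences and trigonometric values\<close>

text \<open>In this division-free form of the coefficients, every recurrence for \<open>P_poly\<close> is Pascal's rule.
The quotient is removed by \<open>(2k+1) * C(n, 2k+1) = (n-2k) * C(n, 2k)\<close> with \<open>n = m+k\<close>,
because \<open>2m+1 = (2k+1) + 2(m-k)\<close>.\<close>
lemma coeff_P_poly:
  "coeff (P_poly m :: 'a::field_char_0 poly) k =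
     of_nat ((m+k) choose (2*k)) + 2 * of_nat ((m+k) choose (2*k+1))"
proof (cases "k \<le> m")
  case True
  have "(2*k+1) * ((m+k) choose (2*k+1)) = (m+k - 2*k) * ((m+k) choose (2*k))"
    using binomial_absorption[of "2*k" "m+k"] binomial_absorb_comp[of "m+k" "2*k"] by simp
  also have "m+k - 2*k = m - k" by simp
  finally have "of_nat ((2*k+1) * ((m+k) choose (2*k+1))) =
      (of_nat ((m-k) * ((m+k) choose (2*k))) :: 'a)" by (rule arg_cong)
  hence *: "(of_nat (2*k+1) :: 'a) * of_nat ((m+k) choose (2*k+1)) =
      (of_nat m - of_nat k) * of_nat ((m+k) choose (2*k))"
    using True by (simp only: of_nat_mult of_nat_diff)
  have nz: "(of_nat (2*k+1) :: 'a) \<noteq> 0" by (simp only: of_nat_eq_0_iff)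
  have "coeff (P_poly m :: 'a poly) k = of_nat (2*m+1) / of_nat (2*k+1) * of_nat ((m+k) choose (2*k))"
    using True by (simp add: P_poly_def coeff_sum)
  also have "\<dots> = of_nat ((m+k) choose (2*k)) + 2 * of_nat ((m+k) choose (2*k+1))"
  proof -
    have "of_nat (2*m+1) * of_nat ((m+k) choose (2*k)) =
       (of_nat (2*k+1) :: 'a) * (of_nat ((m+k) choose (2*k)) + 2 * of_nat ((m+k) choose (2*k+1)))"
      unfolding distrib_left mult.left_commute[of _ 2] * by (simp add: algebra_simps)
    thus ?thesis using nz by (simp add: field_simps)
  qed
  finally show ?thesis .
next
  case False
  hence "coeff (P_poly m :: 'a poly) k = 0"
    by (simp add: P_poly_def coeff_sum)
  thus ?thesis using False by (simp add: binomial_eq_0)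
qed

lemma coeff_Q_poly:
  "m \<ge> 1 \<Longrightarrow> coeff (Q_poly m :: 'a::field_char_0 poly) k =
     of_nat ((m+k) choose (2*k)) + of_nat ((m+k-1) choose (2*k))"
proof -
  assume m: "m \<ge> 1"
  consider "k = 0" | "k \<ge> 1" "k \<le> m" | "k > m" by linarith
  thus ?thesis
  proof cases
    case 1
    thus ?thesis by (simp add: Q_poly_def coeff_sum)
  next
    case 2
    obtain l where k: "k = Suc l" using 2 by (cases k) auto
    define n where "n = m + l"
    have "(2*l+2) * (n choose (2*l+2)) = (n - (2*l+1)) * (n choose (2*l+1))"
      using binomial_absorption[of "2*l+1" n] binomial_absorb_comp[of n "2*l+1"] by simp
    also have "n - (2*l+1) = m - k" unfolding n_def k by simp
    finally have "of_nat ((2*k) * (n choose (2*k))) = (of_nat ((m - k) * (n choose (2*k-1))) :: 'a)"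
      by (simp add: k)
    hence *: "2 * of_nat k * (of_nat (n choose (2*k)) :: 'a) =
        (of_nat m - of_nat k) * of_nat (n choose (2*k-1))"
      using 2 by (simp only: of_nat_mult of_nat_diff of_nat_numeral)
    have pascal: "(m+k) choose (2*k) = (n choose (2*k-1)) + (n choose (2*k))"
      by (simp add: k n_def)
    have "coeff (Q_poly m :: 'a poly) k = of_nat m / of_nat k * of_nat ((m+k-1) choose (2*k-1))"
      using 2 by (simp add: Q_poly_def coeff_sum coeff_pCons split: nat.splits)
    also have "\<dots> = of_nat (n choose (2*k-1)) + 2 * of_nat (n choose (2*k))"
      using * 2 by (simp add: n_def k field_simps del: of_nat_Suc binomial_Suc_Suc)
    finally show ?thesis using pascal by (simp add: n_def k)
  next
    case 3
    hence "coeff (Q_poly m :: 'a poly) k = 0"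
      by (simp add: Q_poly_def coeff_sum coeff_pCons split: nat.splits)
    thus ?thesis using 3 by (simp add: binomial_eq_0)
  qed
qed

text \<open>The polynomial form of
\<open>sin((2m+3)\<theta>) - sin((2m+1)\<theta>) = 2 cos((2m+2)\<theta>) sin \<theta>\<close>; through it the values
of \<open>Q_poly\<close> are inherited from \<open>P_poly\<close>.\<close>
lemma Q_poly_Suc: "Q_poly (Suc m) = (P_poly (Suc m) - P_poly m :: 'a::field_char_0 poly)"
proof (rule poly_eqI)
  fix k
  show "coeff (Q_poly (Suc m)) k = coeff (P_poly (Suc m) - P_poly m :: 'a poly) k"
    by (cases k) (simp_all add: coeff_Q_poly coeff_P_poly algebra_simps)
qed

lemma P_poly_0: "P_poly 0 = 1"
  by (simp add: P_poly_def monom_0)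

lemma P_poly_1: "P_poly (Suc 0) = [:3, 1:]"
  by (rule poly_eqI) (auto simp: coeff_P_poly coeff_pCons numeral_eq_Suc binomial_eq_0 split: nat.splits)

text \<open>The second difference in \<open>m\<close> of \<open>C(m+k, n)\<close> is \<open>C(m+k, n-2)\<close>, and lowering \<open>n\<close> by 2
is the same as passing from \<open>P_poly (m+1)\<close> at \<open>k\<close> to its coefficient at \<open>k-1\<close>.\<close>
lemma P_poly_Suc_Suc:
  "P_poly (Suc (Suc m)) = ([:2, 1:] * P_poly (Suc m) - P_poly m :: 'a::field_char_0 poly)"
proof (rule poly_eqI)
  fix k
  show "coeff (P_poly (Suc (Suc m))) k = coeff ([:2, 1:] * P_poly (Suc m) - P_poly m :: 'a poly) k"
    by (cases k) (simp_all add: coeff_P_poly algebra_simps)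
qed

lemma coeff_V_poly:
  "coeff (V_poly m :: 'a::field_char_0 poly) k =
     (-1) ^ (k + (m+k) div 2) * of_nat (((m+k) div 2) choose k)"
  by (auto simp: V_poly_def coeff_sum binomial_eq_0)

lemma V_poly_Suc_Suc:
  "V_poly (Suc (Suc m)) = ([:0, 1:] * V_poly (Suc m) - V_poly m :: 'a::field_char_0 poly)"
proof (rule poly_eqI)
  fix k
  show "coeff (V_poly (Suc (Suc m))) k = coeff ([:0, 1:] * V_poly (Suc m) - V_poly m :: 'a poly) k"
    by (cases k) (simp_all add: coeff_V_poly algebra_simps)
qed

text \<open>Both sides satisfy \<open>y(m+2) = x * y(m+1) - y(m)\<close>: the shift by 2 cancels the 2 in the
recurrence of \<open>P_poly\<close>.\<close>
lemma poly_V_poly: "poly (V_poly m) x = poly (P_poly m) (x - 2 :: 'a::field_char_0)"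
proof -
  have "poly (V_poly m) x = poly (P_poly m) (x - 2) \<and>
        poly (V_poly (Suc m)) x = poly (P_poly (Suc m)) (x - 2)"
  proof (induction m)
    case 0
    have "V_poly 0 = (1 :: 'a poly)" by (simp add: V_poly_def monom_0)
    moreover have "V_poly (Suc 0) = ([:1, 1:] :: 'a poly)"
      by (rule poly_eqI) (auto simp: coeff_V_poly coeff_pCons binomial_eq_0 split: nat.splits)
    ultimately show ?case by (simp add: P_poly_0 P_poly_1)
  next
    case (Suc m)
    thus ?case by (simp add: V_poly_Suc_Suc P_poly_Suc_Suc algebra_simps)
  qed
  thus ?thesis ..
qed

lemma degree_P_poly: "degree (P_poly m :: 'a::field_char_0 poly) = m"
  and P_poly_monic: "coeff (P_poly m :: 'a poly) m = 1"
proof -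
  show *: "coeff (P_poly m :: 'a poly) m = 1"
    by (simp add: coeff_P_poly binomial_eq_0 flip: mult_2)
  have "degree (P_poly m :: 'a poly) \<le> m"
    by (rule degree_le) (simp add: coeff_P_poly binomial_eq_0)
  moreover have "degree (P_poly m :: 'a poly) \<ge> m"
    by (rule le_degree) (simp add: *)
  ultimately show "degree (P_poly m :: 'a poly) = m" by simp
qed

lemma lead_coeff_Q_poly:
  assumes "m \<ge> 1"
  shows "lead_coeff (Q_poly m :: 'a::field_char_0 poly) = 1"
proof -
  have *: "coeff (Q_poly m :: 'a poly) m = 1"
    using assms by (simp add: coeff_Q_poly binomial_eq_0 flip: mult_2)
  have "degree (Q_poly m :: 'a poly) \<le> m"
    using assms by (intro degree_le) (auto simp: coeff_Q_poly binomial_eq_0)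
  moreover have "degree (Q_poly m :: 'a poly) \<ge> m"
    by (rule le_degree) (simp add: *)
  ultimately have "degree (Q_poly m :: 'a poly) = m" by simp
  thus ?thesis using * by simp
qed

lemma sin_add_recurrence: "sin (a + b) = 2 * cos b * sin a - sin (a - b)" for a b :: real
  by (simp add: sin_add sin_diff)

text \<open>The argument \<open>2 cos(2\<theta>) - 2 = -(2 sin \<theta>)\<^sup>2\<close> turns the recurrence of \<open>P_poly\<close> into that of the
Dirichlet kernel \<open>sin((2m+1)\<theta>) / sin \<theta>\<close>.\<close>
lemma poly_P_poly_sin:
  "poly (P_poly m) (2 * cos (2 * \<theta>) - 2) * sin \<theta> = sin (real (2*m+1) * \<theta>)"
proof -
  have "poly (P_poly m) (2 * cos (2 * \<theta>) - 2) * sin \<theta> = sin (real (2*m+1) * \<theta>) \<and>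
        poly (P_poly (Suc m)) (2 * cos (2 * \<theta>) - 2) * sin \<theta> = sin (real (2*(Suc m)+1) * \<theta>)"
  proof (induction m)
    case 0
    have "sin (3 * \<theta>) = 2 * cos (2*\<theta>) * sin \<theta> - sin (-\<theta>)"
      using sin_add_recurrence[of \<theta> "2*\<theta>"] by simp
    thus ?case by (simp add: P_poly_0 P_poly_1 algebra_simps)
  next
    case (Suc m)
    have e: "real (2*(Suc m)+1) * \<theta> + 2*\<theta> = real (2*(Suc (Suc m))+1) * \<theta>"
      "real (2*(Suc m)+1) * \<theta> - 2*\<theta> = real (2*m+1) * \<theta>" by (simp_all add: algebra_simps)
    have "poly (P_poly (Suc (Suc m))) (2 * cos (2 * \<theta>) - 2) * sin \<theta> =
       2 * cos (2 * \<theta>) * (poly (P_poly (Suc m)) (2 * cos (2 * \<theta>) - 2) * sin \<theta>)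
       - poly (P_poly m) (2 * cos (2 * \<theta>) - 2) * sin \<theta>"
      by (simp add: P_poly_Suc_Suc algebra_simps)
    also have "\<dots> = sin (real (2*(Suc (Suc m))+1) * \<theta>)"
      using sin_add_recurrence[of "real (2*(Suc m)+1) * \<theta>" "2*\<theta>"] Suc unfolding e by simp
    finally show ?case using Suc by blast
  qed
  thus ?thesis ..
qed

lemma poly_Q_poly_cos:
  assumes "m \<ge> 1" "sin \<theta> \<noteq> 0"
  shows "poly (Q_poly m) (2 * cos (2 * \<theta>) - 2) = 2 * cos (real (2*m) * \<theta>)"
proof -
  obtain n where m: "m = Suc n" using assms by (cases m) auto
  have e: "real (2*m+1) * \<theta> = real (2*m) * \<theta> + \<theta>" "real (2*n+1) * \<theta> = real (2*m) * \<theta> - \<theta>"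
    by (simp_all add: m algebra_simps)
  have "poly (Q_poly m) (2 * cos (2 * \<theta>) - 2) * sin \<theta> = 2 * cos (real (2*m) * \<theta>) * sin \<theta>"
    using poly_P_poly_sin[of m \<theta>] poly_P_poly_sin[of n \<theta>] unfolding e
    by (simp add: m Q_poly_Suc left_diff_distrib sin_add sin_diff)
  thus ?thesis using assms by simp
qed

lemma cheb_T_cos: "poly (cheb_T n) (cos \<theta>) = cos (real n * \<theta>)"
proof (induction n rule: cheb_T.induct)
  case (3 n)
  have e: "real (Suc (Suc n)) * \<theta> = real (Suc n) * \<theta> + \<theta>" "real n * \<theta> = real (Suc n) * \<theta> - \<theta>"
    by (simp_all add: algebra_simps)
  show ?case using 3 unfolding e by (simp add: cos_add cos_diff)
qed auto

lemma cheb_U_sin: "poly (cheb_U n) (cos \<theta>) * sin \<theta> = sin (real (n+1) * \<theta>)"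
proof (induction n rule: cheb_U.induct)
  case 1
  show ?case by simp
next
  case 2
  show ?case using sin_double[of \<theta>] by simp
next
  case (3 n)
  have e: "real (Suc (Suc n)+1) * \<theta> = real (Suc n+1) * \<theta> + \<theta>"
     "real (n+1) * \<theta> = real (Suc n+1) * \<theta> - \<theta>"
    by (simp_all add: algebra_simps)
  have "poly (cheb_U (Suc (Suc n))) (cos \<theta>) * sin \<theta> =
      2 * cos \<theta> * (poly (cheb_U (Suc n)) (cos \<theta>) * sin \<theta>) - poly (cheb_U n) (cos \<theta>) * sin \<theta>"
    by (simp add: algebra_simps)
  thus ?case unfolding 3 unfolding e sin_add_recurrence[of _ \<theta>] by simp
qed

section \<open>Discrete orthogonality at the angles of the roots\<close>

definition theta :: "nat \<Rightarrow> nat \<Rightarrow> real" where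
  "theta m t = pi * real t / real (2*m+1)"

lemma mu_theta: "mu m t = 2 * cos (2 * theta m t) - 2"
  by (simp add: mu_def theta_def field_simps)

lemma theta_full: "real (2*m+1) * theta m t = real t * pi"
  by (simp add: theta_def)

lemma theta_bounds:
  assumes "t \<in> {1..m}"
  shows "0 < theta m t" "theta m t < pi / 2"
proof -
  show "0 < theta m t" using assms by (simp add: theta_def)
  have "pi * (2 * real t) < pi * real (2*m+1)"
    using assms by (intro mult_strict_left_mono) auto
  thus "theta m t < pi / 2" by (simp add: theta_def field_simps)
qed

lemma sin_theta_pos: "t \<in> {1..m} \<Longrightarrow> sin (theta m t) > 0"
  using theta_bounds[of t m] by (intro sin_gt_zero) auto

lemma chord_sq: "2 * cos (2 * \<theta>) - 2 = - (2 * sin \<theta>)\<^sup>2" for \<theta> :: real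
  by (simp add: cos_double_sin power2_eq_square)

lemma mu_nz: "t \<in> {1..m} \<Longrightarrow> mu m t \<noteq> 0"
  using sin_theta_pos[of t m] by (simp add: mu_theta chord_sq)

lemma inj_on_mu: "inj_on (mu m) {1..m}"
proof (rule inj_onI)
  fix s t assume st: "s \<in> {1..m}" "t \<in> {1..m}" "mu m s = mu m t"
  hence "cos (2 * theta m s) = cos (2 * theta m t)" by (simp add: mu_theta)
  hence "2 * theta m s = 2 * theta m t"
    using theta_bounds[OF st(1)] theta_bounds[OF st(2)] by - (rule cos_inj_pi, auto)
  thus "s = t" by (simp add: theta_def)
qed

text \<open>After multiplication by \<open>sin a\<close> the sum telescopes.\<close>
lemma dirichlet_kernel:
  fixes a :: real
  shows "(\<Sum>t=1..m. 2 * cos (2 * real t * a)) * sin a = sin (real (2*m+1) * a) - sin a"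
proof (induction m)
  case (Suc m)
  define b where "b = 2 * real (Suc m) * a"
  have e: "real (2*Suc m+1) * a = b + a" "real (2*m+1) * a = b - a"
    by (simp_all add: b_def algebra_simps)
  have "(\<Sum>t=1..Suc m. 2 * cos (2 * real t * a)) * sin a =
      (\<Sum>t=1..m. 2 * cos (2 * real t * a)) * sin a + 2 * cos b * sin a"
    by (simp add: distrib_right b_def)
  also have "\<dots> = sin (b + a) - sin a"
    unfolding Suc e by (simp add: sin_add sin_diff)
  finally show ?case unfolding e .
qed simp

text \<open>Integer frequencies are allowed because products of sines and cosines produce differences of
frequencies of either sign.\<close>
lemma sum_cos_theta:
  fixes n :: int
  assumes "n \<noteq> 0" "\<bar>n\<bar> < 2 * int m + 1"
  shows "(\<Sum>t=1..m. 2 * cos (2 * of_int n * theta m t)) = -1"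
proof -
  define a where "a = pi * real_of_int \<bar>n\<bar> / real (2*m+1)"
  have "real_of_int \<bar>n\<bar> < real (2*m+1)" using assms(2) by linarith
  hence "pi * real_of_int \<bar>n\<bar> < pi * real (2*m+1)" by (intro mult_strict_left_mono) auto
  hence "0 < a" "a < pi" using assms by (simp_all add: a_def field_simps)
  hence pos: "sin a > 0" by (rule sin_gt_zero)
  have "real (2*m+1) * a = of_int \<bar>n\<bar> * pi" by (simp add: a_def)
  hence z: "sin (real (2*m+1) * a) = 0" by (metis sin_integer_2pi sin_zero_iff_int2)
  have "cos (2 * of_int n * theta m t) = cos (2 * real t * a)" for t
  proof -
    have "2 * of_int n * theta m t = 2 * real t * a \<or> 2 * of_int n * theta m t = - (2 * real t * a)"
      by (auto simp: theta_def a_def abs_if)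
    thus ?thesis by (elim disjE) (simp_all only: cos_minus)
  qed
  hence "(\<Sum>t=1..m. 2 * cos (2 * of_int n * theta m t)) * sin a = - sin a"
    using dirichlet_kernel[where m=m and a=a] unfolding z by simp
  hence "((\<Sum>t=1..m. 2 * cos (2 * of_int n * theta m t)) + 1) * sin a = 0"
    by (simp add: distrib_right)
  thus ?thesis using pos by (simp add: eq_neg_iff_add_eq_0)
qed

lemma sum_cos_theta_nat:
  assumes "0 < n" "n < 2 * m + 1"
  shows "(\<Sum>t=1..m. 2 * cos (real (2*n) * theta m t)) = -1"
  using sum_cos_theta[of "int n" m] assms by simp

lemma sum_cos_theta_diff:
  assumes "j < m" "k < m"
  shows "(\<Sum>t=1..m. 2 * cos (2 * (real j - real k) * theta m t)) =
           (if j = k then real (2*m+1) else 0) - 1"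
proof (cases "j = k")
  case False
  thus ?thesis using sum_cos_theta[of "int j - int k" m] assms by simp
qed simp

lemma sin_orthogonality:
  assumes "j < m" "k < m"
  shows "(\<Sum>t=1..m. (2 * sin (real (2*j+1) * theta m t)) * (2 * sin (real (2*k+1) * theta m t)))
           = (if j = k then real (2*m+1) else 0)"
proof -
  have "(2 * sin (real (2*j+1) * x)) * (2 * sin (real (2*k+1) * x)) =
          2 * cos (2 * (real j - real k) * x) - 2 * cos (real (2*(j+k+1)) * x)" for x
  proof -
    have e: "2 * (real j - real k) * x = real (2*j+1) * x - real (2*k+1) * x"
      "real (2*(j+k+1)) * x = real (2*j+1) * x + real (2*k+1) * x" by (simp_all add: algebra_simps)
    show ?thesis unfolding e by (simp add: cos_add cos_diff)
  qed
  thus ?thesis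
    using sum_cos_theta_diff[OF assms] sum_cos_theta_nat[of "j+k+1" m] assms
    by (simp add: sum_subtractf del: of_nat_mult of_nat_add)
qed

text \<open>The cosines alone are not orthogonal over \<open>t = 1, \<dots>, m\<close>: the point \<open>t = 0\<close> is missing, and
each inner product is off by the same constant \<open>-2\<close>. Subtracting 2, the value at \<open>t = 0\<close>,
from one of the two families corrects this.\<close>
lemma cos_biorthogonality:
  assumes "j < m" "k < m"
  shows "(\<Sum>t=1..m. (2 * cos (real (2*(j+1)) * theta m t)) * (2 * cos (real (2*(k+1)) * theta m t) - 2))
           = (if j = k then real (2*m+1) else 0)"
proof -
  have "(2 * cos (real (2*(j+1)) * x)) * (2 * cos (real (2*(k+1)) * x) - 2) =
          2 * cos (2 * (real j - real k) * x) + 2 * cos (real (2*(j+k+2)) * x)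
          - 2 * (2 * cos (real (2*(j+1)) * x))" for x
  proof -
    have e: "2 * (real j - real k) * x = real (2*(j+1)) * x - real (2*(k+1)) * x"
      "real (2*(j+k+2)) * x = real (2*(j+1)) * x + real (2*(k+1)) * x" by (simp_all add: algebra_simps)
    show ?thesis unfolding e cos_add cos_diff by (simp add: algebra_simps del: of_nat_mult of_nat_add)
  qed
  thus ?thesis
    using sum_cos_theta_diff[OF assms] sum_cos_theta_nat[of "j+k+2" m] sum_cos_theta_nat[of "j+1" m] assms
    by (simp add: sum_subtractf sum.distrib sum_distrib_left[symmetric] del: of_nat_mult of_nat_add)
qed

section \<open>Powers of the chord in multiple angles\<close>

lemma cis_diff_power:
  "(cis a - cis (-a)) ^ n =
     (\<Sum>k\<le>n. complex_of_real ((-1) ^ k * real (n choose k)) * cis ((real n - 2 * real k) * a))"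
proof -
  have "(cis a - cis (-a)) ^ n = (- cis (-a) + cis a) ^ n" by simp
  also have "\<dots> = (\<Sum>k\<le>n. of_nat (n choose k) * (- cis (-a)) ^ k * cis a ^ (n - k))"
    by (rule binomial_ring)
  also have "\<dots> = (\<Sum>k\<le>n. complex_of_real ((-1) ^ k * real (n choose k)) * cis ((real n - 2 * real k) * a))"
  proof (rule sum.cong[OF refl])
    fix k assume "k \<in> {..n}"
    hence "real k * (- a) + real (n - k) * a = (real n - 2 * real k) * a"
      by (simp add: of_nat_diff algebra_simps)
    hence "cis (-a) ^ k * cis a ^ (n - k) = cis ((real n - 2 * real k) * a)"
      by (simp only: DeMoivre cis_mult)
    thus "of_nat (n choose k) * (- cis (-a)) ^ k * cis a ^ (n - k) =
       complex_of_real ((-1) ^ k * real (n choose k)) * cis ((real n - 2 * real k) * a)"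
      by (simp add: power_minus[of "cis (-a)"] mult.assoc mult.left_commute)
  qed
  finally show ?thesis .
qed

lemma cis_diff_even_power:
  "(cis a - cis (-a)) ^ (2 * i) = complex_of_real ((2 * cos (2 * a) - 2) ^ i)"
proof -
  have "(cis a - cis (-a))\<^sup>2 = complex_of_real (2 * cos (2 * a) - 2)"
    unfolding chord_sq by (simp add: complex_eq_iff power2_eq_square)
  thus ?thesis by (simp add: power_mult)
qed

lemma sum_fold_odd:
  fixes f :: "nat \<Rightarrow> 'a::comm_monoid_add"
  shows "(\<Sum>k\<le>2*i+1. f k) = (\<Sum>k\<le>i. f k + f (2*i+1-k))"
proof -
  have "{..2*i+1} = {..i} \<union> {i+1..2*i+1}" by auto
  hence "(\<Sum>k\<le>2*i+1. f k) = (\<Sum>k\<le>i. f k) + (\<Sum>k\<in>{i+1..2*i+1}. f k)"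
    by (simp only:) (rule sum.union_disjoint; auto)
  also have "(\<Sum>k\<in>{i+1..2*i+1}. f k) = (\<Sum>k\<le>i. f (2*i+1-k))"
    by (rule sum.reindex_bij_witness[of _ "\<lambda>k. 2*i+1-k" "\<lambda>k. 2*i+1-k"]) auto
  finally show ?thesis by (simp add: sum.distrib)
qed

lemma sum_fold_even:
  fixes f :: "nat \<Rightarrow> 'a::comm_monoid_add"
  shows "(\<Sum>k\<le>2*i. f k) = f i + (\<Sum>k<i. f k + f (2*i-k))"
proof -
  have "{..2*i} = insert i {..<i} \<union> {i+1..2*i}" by auto
  hence "(\<Sum>k\<le>2*i. f k) = (\<Sum>k\<in>insert i {..<i}. f k) + (\<Sum>k\<in>{i+1..2*i}. f k)"
    by (simp only:) (rule sum.union_disjoint; auto)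
  also have "(\<Sum>k\<in>{i+1..2*i}. f k) = (\<Sum>k<i. f (2*i-k))"
    by (rule sum.reindex_bij_witness[of _ "\<lambda>k. 2*i-k" "\<lambda>k. 2*i-k"]) auto
  finally show ?thesis by (simp add: sum.distrib add.assoc)
qed

text \<open>The imaginary part of the binomial expansion of \<open>(e^(ia) - e^(-ia))^(2i+1)\<close>, whose terms
\<open>k\<close> and \<open>2i+1-k\<close> coincide. Its coefficients are those of \<open>B_odd\<close>.\<close>
lemma odd_expansion:
  fixes a :: real
  shows "(\<Sum>k\<le>i. (-1) ^ k * real ((2*i+1) choose k) * (2 * sin (real (2*(i-k)+1) * a))) =
           (2 * cos (2 * a) - 2) ^ i * (2 * sin a)"
proof -
  let ?f = "\<lambda>k. (-1) ^ k * real ((2*i+1) choose k) * sin ((real (2*i+1) - 2 * real k) * a)"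
  have "(2 * cos (2 * a) - 2) ^ i * (2 * sin a) = Im ((cis a - cis (-a)) ^ (2*i+1))"
    unfolding power_add cis_diff_even_power by simp
  also have "\<dots> = (\<Sum>k\<le>2*i+1. ?f k)"
    unfolding cis_diff_power by (simp add: Im_sum del: of_real_mult)
  also have "\<dots> = (\<Sum>k\<le>i. ?f k + ?f (2*i+1-k))" by (rule sum_fold_odd)
  also have "\<dots> = (\<Sum>k\<le>i. (-1) ^ k * real ((2*i+1) choose k) * (2 * sin (real (2*(i-k)+1) * a)))"
  proof (rule sum.cong[OF refl])
    fix k assume k: "k \<in> {..i}"
    have b: "((2*i+1) choose (2*i+1-k)) = ((2*i+1) choose k)"
      using k by (intro binomial_symmetric[symmetric]) auto
    have s: "(-1::real) ^ (2*i+1-k) = - ((-1) ^ k)"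
      using k by (auto simp: minus_one_power_iff)
    have e: "(real (2*i+1) - 2 * real k) * a = real (2*(i-k)+1) * a"
       "(real (2*i+1) - 2 * real (2*i+1-k)) * a = - (real (2*(i-k)+1) * a)"
      using k by (simp_all add: of_nat_diff algebra_simps)
    show "?f k + ?f (2*i+1-k) = (-1) ^ k * real ((2*i+1) choose k) * (2 * sin (real (2*(i-k)+1) * a))"
      unfolding b s e by simp
  qed
  finally show ?thesis ..
qed

lemma even_expansion_central:
  fixes a :: real
  shows "(-1) ^ i * real ((2*i) choose i) +
      (\<Sum>k<i. (-1) ^ k * real ((2*i) choose k) * (2 * cos (real (2*(i-k)) * a))) = (2 * cos (2 * a) - 2) ^ i"
proof -
  let ?f = "\<lambda>k. (-1) ^ k * real ((2*i) choose k) * cos ((real (2*i) - 2 * real k) * a)"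
  have "(2 * cos (2 * a) - 2) ^ i = Re ((cis a - cis (-a)) ^ (2*i))"
    unfolding cis_diff_even_power by simp
  also have "\<dots> = (\<Sum>k\<le>2*i. ?f k)"
    unfolding cis_diff_power by (simp add: Re_sum del: of_real_mult)
  also have "\<dots> = ?f i + (\<Sum>k<i. ?f k + ?f (2*i-k))" by (rule sum_fold_even)
  also have "(\<Sum>k<i. ?f k + ?f (2*i-k)) = (\<Sum>k<i. (-1) ^ k * real ((2*i) choose k) * (2 * cos (real (2*(i-k)) * a)))"
  proof (rule sum.cong[OF refl])
    fix k assume k: "k \<in> {..<i}"
    have b: "((2*i) choose (2*i-k)) = ((2*i) choose k)"
      using k by (intro binomial_symmetric[symmetric]) auto
    have s: "(-1::real) ^ (2*i-k) = (-1) ^ k"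
      using k by (auto simp: minus_one_power_iff)
    have e: "(real (2*i) - 2 * real k) * a = real (2*(i-k)) * a"
       "(real (2*i) - 2 * real (2*i-k)) * a = - (real (2*(i-k)) * a)"
      using k by (simp_all add: of_nat_diff algebra_simps)
    show "?f k + ?f (2*i-k) = (-1) ^ k * real ((2*i) choose k) * (2 * cos (real (2*(i-k)) * a))"
      unfolding b s e by simp
  qed
  finally show ?thesis by simp
qed

text \<open>Subtracting the expansion at \<open>a = 0\<close> removes the central binomial coefficient, for which the
matrix \<open>B_even\<close> has no entry.\<close>
lemma even_expansion:
  fixes a :: real
  assumes "i > 0"
  shows "(\<Sum>k<i. (-1) ^ k * real ((2*i) choose k) * (2 * cos (real (2*(i-k)) * a) - 2)) =
     (2 * cos (2 * a) - 2) ^ i"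
proof -
  have "(\<Sum>k<i. (-1) ^ k * real ((2*i) choose k) * (2 * cos (real (2*(i-k)) * a) - 2)) =
     (2 * cos (2 * a) - 2) ^ i - (2 * cos (2 * 0) - 2) ^ i"
    unfolding even_expansion_central[symmetric] by (simp add: right_diff_distrib sum_subtractf)
  thus ?thesis using assms by simp
qed

text \<open>The columns of \<open>B_odd\<close> write the powers of \<open>2 cos(2a) - 2\<close>, up to a factor independent of
the column, in terms of the sines of the odd multiples of \<open>a\<close>.\<close>
lemma B_odd_dual:
  assumes "i < m"
  shows "(\<Sum>j<m. 2 * sin (real (2*j+1) * a) * B_odd m $$ (j, i)) * (2 * sin a) = (2 * cos (2 * a) - 2) ^ Suc i"
proof -
  have "(\<Sum>j<m. 2 * sin (real (2*j+1) * a) * B_odd m $$ (j, i)) =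
     (\<Sum>j\<le>i. 2 * sin (real (2*j+1) * a) * ((-1) ^ (i+j+1) * real ((2*i+1) choose (i-j))))"
    using assms by (intro sum.mono_neutral_cong_right) (auto simp: B_odd_def mat1_def minus_one_power_iff)
  also have "\<dots> = (\<Sum>k\<le>i. - ((-1) ^ k * real ((2*i+1) choose k) * (2 * sin (real (2*(i-k)+1) * a))))"
    by (rule sum.reindex_bij_witness[of _ "\<lambda>k. i-k" "\<lambda>k. i-k"])
       (auto simp: minus_one_power_iff)
  also have "\<dots> = - ((2 * cos (2 * a) - 2) ^ i * (2 * sin a))"
    by (simp only: sum_negf odd_expansion)
  finally have "(\<Sum>j<m. 2 * sin (real (2*j+1) * a) * B_odd m $$ (j, i)) * (2 * sin a) =
     (2 * cos (2 * a) - 2) ^ i * (- (2 * sin a)\<^sup>2)" by (simp add: power2_eq_square)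
  thus ?thesis by (simp only: chord_sq power_Suc2)
qed

text \<open>The counterpart for even multiples. The subtracted 2 is the one that
\<open>cos_biorthogonality\<close> asks for.\<close>
lemma B_even_dual:
  assumes "i < m"
  shows "(\<Sum>j<m. (2 * cos (real (2*(j+1)) * a) - 2) * B_even m $$ (j, i)) = (2 * cos (2 * a) - 2) ^ Suc i"
proof -
  have "(\<Sum>j<m. (2 * cos (real (2*(j+1)) * a) - 2) * B_even m $$ (j, i)) =
     (\<Sum>j\<le>i. (2 * cos (real (2*(j+1)) * a) - 2) * ((-1) ^ (i+j) * real ((2*Suc i) choose (i-j))))"
    using assms by (intro sum.mono_neutral_cong_right) (auto simp: B_even_def mat1_def minus_one_power_iff)
  also have "\<dots> = (\<Sum>k<Suc i. (-1) ^ k * real ((2*Suc i) choose k) * (2 * cos (real (2*(Suc i-k)) * a) - 2))"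
    by (rule sum.reindex_bij_witness[of _ "\<lambda>k. i-k" "\<lambda>k. i-k"])
       (auto simp: minus_one_power_iff Suc_diff_le)
  also have "\<dots> = (2 * cos (2 * a) - 2) ^ Suc i" by (rule even_expansion) simp
  finally show ?thesis .
qed

section \<open>Factorization over the roots\<close>

lemma mu_root:
  assumes "t \<in> {1..m}"
  shows "poly (P_poly m) (mu m t) = 0"
proof -
  have "poly (P_poly m) (mu m t) * sin (theta m t) = 0"
    unfolding mu_theta poly_P_poly_sin theta_full by (simp only: sin_npi)
  thus ?thesis using sin_theta_pos[OF assms] by simp
qed

text \<open>Both sides are monic of degree \<open>m\<close> and agree at \<open>m\<close> distinct points.\<close>
lemma P_poly_factor: "P_poly m = (\<Prod>t=1..m. [:- mu m t, 1:])"
proof (rule poly_eqI_degree_lead_coeff[where n = m and A = "mu m ` {1..m}"])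
  have d: "degree (\<Prod>t=1..m. [:- mu m t, 1:]) = m"
    by (subst degree_prod_sum_eq) auto
  have "lead_coeff (\<Prod>t=1..m. [:- mu m t, 1:]) = 1"
    by (simp add: lead_coeff_prod)
  thus "coeff (P_poly m) m = coeff (\<Prod>t=1..m. [:- mu m t, 1:]) m"
    unfolding d P_poly_monic ..
  show "m \<le> card (mu m ` {1..m})" by (simp only: card_image[OF inj_on_mu]) simp
  show "degree (\<Prod>t=1..m. [:- mu m t, 1:]) \<le> m" by (simp only: d order.refl)
  show "degree (P_poly m :: real poly) \<le> m" by (simp add: degree_P_poly)
  show "poly (P_poly m) z = poly (\<Prod>t=1..m. [:- mu m t, 1:]) z" if "z \<in> mu m ` {1..m}" for z
    using that by (auto simp: poly_prod mu_root intro!: bexI)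
qed

lemma poly_P_poly_prod: "poly (P_poly m) x = (\<Prod>t=1..m. x - mu m t)"
  by (subst P_poly_factor) (simp add: poly_prod)

lemma proots_P_poly: "proots (P_poly m) = image_mset (mu m) (mset_set {1..m})"
proof -
  have "proots (P_poly m) = (\<Sum>t=1..m. {#mu m t#})"
    unfolding P_poly_factor by (subst proots_prod) auto
  also have "\<dots> = image_mset (mu m) (mset_set {1..m})"
    by (simp add: sum_unfold_sum_mset multiset.map_comp o_def)
  finally show ?thesis .
qed

lemma P_poly_deriv_prod:
  assumes "k \<in> {1..m}"
  shows "poly (pderiv (P_poly m)) (mu m k) = (\<Prod>j\<in>{1..m} - {k}. mu m k - mu m j)"
proof -
  let ?q = "\<Prod>t\<in>{1..m} - {k}. [:- mu m t, 1:]"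
  have "P_poly m = [:- mu m k, 1:] * ?q"
    unfolding P_poly_factor using assms by (simp only: prod.remove finite_atLeastAtMost)
  hence "poly (pderiv (P_poly m)) (mu m k) = poly ?q (mu m k)"
    by (simp only: pderiv_mult) (simp add: pderiv_pCons)
  thus ?thesis by (simp add: poly_prod)
qed

text \<open>Differentiating \<open>poly_P_poly_sin\<close> in \<open>\<theta>\<close> at a zero: the term with the derivative of
\<open>sin \<theta>\<close> vanishes together with the polynomial.\<close>
lemma P_poly_deriv_trig:
  fixes \<theta> :: real
  assumes "sin (real (2*m+1) * \<theta>) = 0" "sin \<theta> \<noteq> 0"
  shows "poly (pderiv (P_poly m)) (2 * cos (2 * \<theta>) - 2) * (- (4 * sin (2 * \<theta>))) * sin \<theta> =
           real (2*m+1) * cos (real (2*m+1) * \<theta>)"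
proof -
  let ?p = "P_poly m :: real poly" and ?u = "2 * cos (2 * \<theta>) - 2"
  have "((\<lambda>x. poly ?p (2 * cos (2 * x) - 2) * sin x) has_real_derivative
          poly (pderiv ?p) ?u * (- (4 * sin (2 * \<theta>))) * sin \<theta> + cos \<theta> * poly ?p ?u) (at \<theta>)"
    by (rule derivative_eq_intros poly_DERIV DERIV_chain2[OF poly_DERIV] refl | simp)+
  moreover have "((\<lambda>x. sin (real (2*m+1) * x)) has_real_derivative
          real (2*m+1) * cos (real (2*m+1) * \<theta>)) (at \<theta>)"
    by (rule derivative_eq_intros refl | simp)+
  ultimately have "poly (pderiv ?p) ?u * (- (4 * sin (2 * \<theta>))) * sin \<theta> + cos \<theta> * poly ?p ?u =
      real (2*m+1) * cos (real (2*m+1) * \<theta>)"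
    unfolding poly_P_poly_sin by (rule DERIV_unique)
  moreover have "poly ?p ?u = 0"
    using poly_P_poly_sin[of m \<theta>] assms by simp
  ultimately show ?thesis by simp
qed

lemma Q_poly_complex_prod:
  fixes \<nu> :: "nat \<Rightarrow> complex"
  assumes "j \<ge> 1" "proots (Q_poly j :: complex poly) = image_mset \<nu> (mset_set {1..j})"
  shows "poly (Q_poly j) z = (\<Prod>k=1..j. z - \<nu> k)"
proof -
  have "Q_poly j = (\<Prod>x\<in>#proots (Q_poly j). [:- x, 1:] :: complex poly)"
    using complex_poly_decompose_multiset[of "Q_poly j"] lead_coeff_Q_poly[OF assms(1), where 'a = complex]
    by simp
  also have "\<dots> = (\<Prod>k=1..j. [:- \<nu> k, 1:])"
    unfolding assms(2) by (simp add: prod_unfold_prod_mset multiset.map_comp o_def)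
  finally have "poly (Q_poly j) z = poly (\<Prod>k=1..j. [:- \<nu> k, 1:]) z" by (rule arg_cong)
  thus ?thesis by (simp add: poly_prod)
qed

lemma poly_Q_poly_of_real: "poly (Q_poly j) (complex_of_real x) = complex_of_real (poly (Q_poly j) x)"
  by (simp add: Q_poly_def poly_sum poly_monom)

lemma P_poly_h_coeff: "poly (P_poly m) x = real (2*m+1) * (\<Sum>k\<le>m. h_coeff m k * x ^ k)"
  by (simp add: P_poly_def poly_sum poly_monom h_coeff_def sum_distrib_left mult_ac)

section \<open>Powers of the companion matrix\<close>

text \<open>The eigenvector is the geometric row \<open>(x, x\<^sup>2, \<dots>, x^m)\<close>; its exponents start at 1 while the
matrix indices start at 0.\<close>
definition left_eigen :: "real mat \<Rightarrow> nat \<Rightarrow> real \<Rightarrow> real \<Rightarrow> bool" where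
  "left_eigen A m x c \<longleftrightarrow> (\<forall>j<m. (\<Sum>i<m. x ^ Suc i * A $$ (i, j)) = c * x ^ Suc j)"

lemma mat_mult_index:
  assumes "A \<in> carrier_mat m m" "B \<in> carrier_mat m m" "i < m" "j < m"
  shows "(A * B) $$ (i, j) = (\<Sum>k<m. A $$ (i, k) * B $$ (k, j))"
  using assms by (auto simp: scalar_prod_def lessThan_atLeast0)

lemma left_sum_mult:
  assumes "A \<in> carrier_mat m m" "B \<in> carrier_mat m m" "j < m"
  shows "(\<Sum>i<m. u i * (A * B) $$ (i, j)) = (\<Sum>k<m. (\<Sum>i<m. u i * A $$ (i, k)) * B $$ (k, j))"
proof -
  have "(\<Sum>i<m. u i * (A * B) $$ (i, j)) = (\<Sum>i<m. \<Sum>k<m. u i * A $$ (i, k) * B $$ (k, j))"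
    by (intro sum.cong refl) (auto simp: mat_mult_index[OF assms(1,2)] assms(3) sum_distrib_left mult.assoc)
  also have "\<dots> = (\<Sum>k<m. \<Sum>i<m. u i * A $$ (i, k) * B $$ (k, j))" by (rule sum.swap)
  finally show ?thesis by (simp add: sum_distrib_right)
qed

lemma left_eigen_one: "left_eigen (1\<^sub>m m) m x 1"
proof -
  have "(\<Sum>i<m. x ^ Suc i * 1\<^sub>m m $$ (i, j)) = x ^ Suc j" if "j < m" for j
  proof -
    have "(\<Sum>i<m. x ^ Suc i * 1\<^sub>m m $$ (i, j)) = (\<Sum>i<m. if i = j then x ^ Suc i else 0)"
      using that by (intro sum.cong) auto
    thus ?thesis using that by simp
  qed
  thus ?thesis by (simp add: left_eigen_def)
qed

lemma left_eigen_mult_eq: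
  assumes "A \<in> carrier_mat m m" "B \<in> carrier_mat m m" "left_eigen A m x a" "j < m"
  shows "(\<Sum>i<m. x ^ Suc i * (A * B) $$ (i, j)) = a * (\<Sum>i<m. x ^ Suc i * B $$ (i, j))"
proof -
  have "(\<Sum>i<m. x ^ Suc i * (A * B) $$ (i, j)) = (\<Sum>k<m. (a * x ^ Suc k) * B $$ (k, j))"
    unfolding left_sum_mult[OF assms(1,2,4)] using assms(3)
    by (intro sum.cong) (auto simp: left_eigen_def simp del: power_Suc)
  thus ?thesis by (simp add: sum_distrib_left mult.assoc)
qed

lemma left_eigen_mult:
  assumes "A \<in> carrier_mat m m" "B \<in> carrier_mat m m" "left_eigen A m x a" "left_eigen B m x b"
  shows "left_eigen (A * B) m x (a * b)"
  using left_eigen_mult_eq[OF assms(1-3)] assms(4) by (simp add: left_eigen_def mult.assoc)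

lemma left_eigen_inverse:
  assumes "A \<in> carrier_mat m m" "B \<in> carrier_mat m m" "A * B = 1\<^sub>m m" "left_eigen A m x a" "a \<noteq> 0"
  shows "left_eigen B m x (inverse a)"
  unfolding left_eigen_def
proof (intro allI impI)
  fix j assume j: "j < m"
  have "a * (\<Sum>i<m. x ^ Suc i * B $$ (i, j)) = x ^ Suc j"
    using left_eigen_mult_eq[OF assms(1,2,4) j] left_eigen_one[of m x] j
    unfolding assms(3) left_eigen_def by (metis mult_1)
  thus "(\<Sum>i<m. x ^ Suc i * B $$ (i, j)) = inverse a * x ^ Suc j"
    using assms(5) by (simp add: field_simps)
qed

lemma R_mat_carrier: "R_mat m \<in> carrier_mat m m"
  by (simp add: R_mat_def mat1_def)

lemma R_mat_index:
  "i < m \<Longrightarrow> j < m \<Longrightarrow> R_mat m $$ (i, j) = (if j = 0 then - h_coeff m (Suc i) else if j = Suc i then 1 else 0)"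
  by (simp add: R_mat_def mat1_def)

text \<open>Up to normalization \<open>R_mat m\<close> is the companion matrix of the reciprocal of \<open>P_poly m\<close>. In the
first column the eigenvector equation is \<open>P_poly m\<close> vanishing at \<open>x\<close>, since the constant
coefficient \<open>h_coeff m 0\<close> is 1; in the other columns it is a shift of the exponent.\<close>
lemma R_mat_left_eigen:
  assumes "poly (P_poly m) x = 0" "x \<noteq> 0"
  shows "left_eigen (R_mat m) m x (inverse x)"
  unfolding left_eigen_def
proof (intro allI impI)
  fix j assume j: "j < m"
  show "(\<Sum>i<m. x ^ Suc i * R_mat m $$ (i, j)) = inverse x * x ^ Suc j"
  proof (cases j)
    case 0
    have "0 = (\<Sum>k\<le>m. h_coeff m k * x ^ k)" using assms by (simp add: P_poly_h_coeff)
    also have "\<dots> = 1 + (\<Sum>i<m. h_coeff m (Suc i) * x ^ Suc i)"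
      by (simp only: sum.atMost_shift) (simp add: h_coeff_def)
    also have "(\<Sum>i<m. h_coeff m (Suc i) * x ^ Suc i) = - (\<Sum>i<m. x ^ Suc i * R_mat m $$ (i, j))"
      unfolding sum_negf[symmetric] using 0 j
      by (intro sum.cong) (auto simp: R_mat_index)
    finally show ?thesis using 0 assms by simp
  next
    case (Suc l)
    have "(\<Sum>i<m. x ^ Suc i * R_mat m $$ (i, j)) = (\<Sum>i<m. if i = l then x ^ Suc i else 0)"
      using Suc j by (intro sum.cong) (auto simp: R_mat_index)
    thus ?thesis using Suc j assms by simp
  qed
qed

text \<open>The inverse is a companion matrix as well, with its distinguished column at the right end. The
value \<open>h_coeff m 0 = 1\<close> lets one formula describe that whole column.\<close>
lemma R_mat_Units:
  assumes "m \<ge> 1"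
  shows "R_mat m \<in> Units (ring_mat TYPE(real) m ())"
proof -
  define c where "c = real (2*m+1)"
  define N where "N = mat m m (\<lambda>(i, j). if Suc j = m then - c * h_coeff m i
                                 else if i = Suc j then 1 else 0)"
  have N: "N \<in> carrier_mat m m" by (simp add: N_def)
  have hm: "h_coeff m m = 1 / c" by (simp add: h_coeff_def c_def flip: mult_2)
  have c: "c \<noteq> 0" by (simp add: c_def)
  have h0: "h_coeff q 0 = 1" for q by (simp add: h_coeff_def)
  have "R_mat m * N = 1\<^sub>m m"
  proof (rule eq_matI)
    fix i j assume "i < dim_row (1\<^sub>m m :: real mat)" "j < dim_col (1\<^sub>m m :: real mat)"
    hence ij: "i < m" "j < m" by auto
    have "(R_mat m * N) $$ (i, j) = (\<Sum>k<m. R_mat m $$ (i, k) * N $$ (k, j))"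
      by (rule mat_mult_index[OF R_mat_carrier N ij])
    also have "\<dots> = (\<Sum>k<m. (if k = 0 then - h_coeff m (Suc i) * N $$ (0, j) else 0) +
                     (if k = Suc i then N $$ (Suc i, j) else 0))"
      using ij by (intro sum.cong) (auto simp: R_mat_index)
    also have "\<dots> = - h_coeff m (Suc i) * N $$ (0, j) + (if Suc i < m then N $$ (Suc i, j) else 0)"
      using assms by (simp add: sum.distrib)
    also have "\<dots> = 1\<^sub>m m $$ (i, j)"
      using ij c by (auto simp: N_def h0 hm not_less less_Suc_eq_le dest!: le_antisym)
    finally show "(R_mat m * N) $$ (i, j) = 1\<^sub>m m $$ (i, j)" .
  qed (auto simp: N_def R_mat_def mat1_def)
  moreover have "N * R_mat m = 1\<^sub>m m"
  proof (rule eq_matI)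
    fix i j assume "i < dim_row (1\<^sub>m m :: real mat)" "j < dim_col (1\<^sub>m m :: real mat)"
    hence ij: "i < m" "j < m" by auto
    obtain n where n: "m = Suc n" using assms by (cases m) auto
    have "(N * R_mat m) $$ (i, j) = (\<Sum>k<m. N $$ (i, k) * R_mat m $$ (k, j))"
      by (rule mat_mult_index[OF N R_mat_carrier ij])
    also have "\<dots> = (\<Sum>k<m. (if k = n then - c * h_coeff m i * R_mat m $$ (n, j) else 0) +
                     (if Suc k = i then R_mat m $$ (k, j) else 0))"
      using ij n by (intro sum.cong) (auto simp: N_def)
    also have "\<dots> = - c * h_coeff m i * R_mat m $$ (n, j) +
                     (case i of 0 \<Rightarrow> 0 | Suc l \<Rightarrow> R_mat m $$ (l, j))"
      using ij n by (simp add: sum.distrib split: nat.splits)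
    also have "\<dots> = 1\<^sub>m m $$ (i, j)"
      using ij n hm c by (auto simp: R_mat_index h0 split: nat.splits)
    finally show "(N * R_mat m) $$ (i, j) = 1\<^sub>m m $$ (i, j)" .
  qed (auto simp: N_def R_mat_def mat1_def)
  ultimately show ?thesis
    using N R_mat_carrier[of m] by (auto simp: Units_def ring_mat_simps)
qed

text \<open>For a negative exponent the eigenvector is kept and the eigenvalue inverted, by
\<open>left_eigen_inverse\<close>; thus no formula for the negative powers themselves is required.\<close>
lemma R_pow_left_eigen:
  assumes "m \<ge> 1"
  shows "R_pow m r \<in> carrier_mat m m"
    and "poly (P_poly m) x = 0 \<Longrightarrow> x \<noteq> 0 \<Longrightarrow> left_eigen (R_pow m r) m x (x powi (-r))"
proof -
  let ?G = "ring_mat TYPE(real) m ()"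
  interpret ring ?G by (rule ring_mat)
  have carr: "carrier ?G = carrier_mat m m" and mul: "mult ?G = (*)" and one: "one ?G = 1\<^sub>m m"
    by (simp_all add: ring_mat_simps)
  have pow: "R_pow m r = (if r < 0 then inv\<^bsub>?G\<^esub> (R_mat m [^]\<^bsub>?G\<^esub> nat (-r)) else R_mat m [^]\<^bsub>?G\<^esub> nat r)"
    unfolding R_pow_def by (rule int_pow_def2)
  have U: "R_mat m \<in> Units ?G" by (rule R_mat_Units[OF assms])
  have Un: "R_mat m [^]\<^bsub>?G\<^esub> n \<in> Units ?G" for n :: nat
  proof (induction n)
    case (Suc n)
    thus ?case using U by (simp only: nat_pow_Suc Units_m_closed)
  qed (simp only: nat_pow_0 Units_one_closed)
  have Cn: "R_mat m [^]\<^bsub>?G\<^esub> n \<in> carrier_mat m m" for n :: nat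
    using Units_closed[OF Un[of n]] unfolding carr .
  have Ci: "inv\<^bsub>?G\<^esub> (R_mat m [^]\<^bsub>?G\<^esub> n) \<in> carrier_mat m m" for n :: nat
    using Units_inv_closed[OF Un[of n]] unfolding carr .
  have inv1: "R_mat m [^]\<^bsub>?G\<^esub> n * inv\<^bsub>?G\<^esub> (R_mat m [^]\<^bsub>?G\<^esub> n) = 1\<^sub>m m" for n :: nat
    using Units_r_inv[OF Un[of n]] unfolding mul one .
  show "R_pow m r \<in> carrier_mat m m"
    by (cases "r < 0") (simp_all only: pow Cn Ci if_True if_False)
  assume x: "poly (P_poly m) x = 0" "x \<noteq> 0"
  have E: "left_eigen (R_mat m [^]\<^bsub>?G\<^esub> n) m x (inverse x ^ n)" for n :: nat
  proof (induction n)
    case 0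
    show ?case using left_eigen_one by (simp add: one)
  next
    case (Suc n)
    have "left_eigen (R_mat m [^]\<^bsub>?G\<^esub> n * R_mat m) m x (inverse x ^ n * inverse x)"
      by (rule left_eigen_mult[OF Cn R_mat_carrier Suc R_mat_left_eigen[OF x]])
    thus ?case by (simp add: mul mult.commute)
  qed
  have Ei: "left_eigen (inv\<^bsub>?G\<^esub> (R_mat m [^]\<^bsub>?G\<^esub> n)) m x (inverse (inverse x ^ n))" for n :: nat
    by (rule left_eigen_inverse[OF Cn Ci inv1 E]) (use x in simp)
  show "left_eigen (R_pow m r) m x (x powi (-r))"
  proof (cases "r < 0")
    case True
    have "x powi (-r) = inverse (inverse x ^ nat (-r))"
      using True by (simp add: power_int_def power_inverse)
    thus ?thesis using Ei[of "nat (-r)"] True by (simp only: pow if_True)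
  next
    case False
    have "x powi (-r) = inverse x ^ nat r"
      using False by (cases "r = 0") (simp_all add: power_int_def)
    thus ?thesis using E[of "nat r"] False by (simp only: pow if_False)
  qed
qed

section \<open>Trigonometric sums for the sequences\<close>

text \<open>Biorthogonality inverts a linear system: the measurements of \<open>x\<close> against the family \<open>w\<close>
determine \<open>x\<close> through the dual family \<open>u\<close>.\<close>
lemma dual_inversion:
  fixes u w :: "nat \<Rightarrow> 'b \<Rightarrow> real"
  assumes dual: "\<And>k. k < m \<Longrightarrow> (\<Sum>t\<in>T. u j t * w k t) = (if j = k then c else 0)"
    and data: "\<And>t. t \<in> T \<Longrightarrow> (\<Sum>k<m. w k t * x k) = c * y t"
    and "j < m" "c \<noteq> 0"
  shows "x j = (\<Sum>t\<in>T. u j t * y t)"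
proof -
  have "c * x j = (\<Sum>k<m. (\<Sum>t\<in>T. u j t * w k t) * x k)"
    using assms(3) by (simp add: dual if_distrib[of "\<lambda>z. z * _"] cong: if_cong)
  also have "\<dots> = (\<Sum>k<m. \<Sum>t\<in>T. u j t * (w k t * x k))"
    by (simp add: sum_distrib_right mult.assoc)
  also have "\<dots> = (\<Sum>t\<in>T. u j t * (\<Sum>k<m. w k t * x k))"
    by (subst sum.swap) (simp add: sum_distrib_left)
  also have "\<dots> = c * (\<Sum>t\<in>T. u j t * y t)"
  proof -
    have "(\<Sum>t\<in>T. u j t * (\<Sum>k<m. w k t * x k)) = (\<Sum>t\<in>T. u j t * (c * y t))"
      by (rule sum.cong) (simp_all only: data)
    thus ?thesis by (simp add: sum_distrib_left mult.left_commute)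
  qed
  finally show ?thesis using assms(4) by simp
qed

text \<open>Rows that \<open>B\<close> maps to multiples of the eigenvector \<open>(x, x\<^sup>2, \<dots>)\<close> at \<open>x = mu m t\<close>
see only the eigenvalue of the power of \<open>R_mat m\<close>. The exponent \<open>1 - r\<close> is \<open>-r\<close> from that
eigenvalue plus 1 from the first entry of the eigenvector.\<close>
lemma row_R_pow:
  assumes "B \<in> carrier_mat m m" "m \<ge> 1" "t \<in> {1..m}"
    and row: "\<And>i. i < m \<Longrightarrow> (\<Sum>j<m. w j * B $$ (j, i)) = d * mu m t ^ Suc i"
  shows "(\<Sum>j<m. w j * (c \<cdot>\<^sub>m (B * R_pow m r)) $$ (j, 0)) = c * (d * mu m t powi (1 - r))"
proof -
  note R = R_pow_left_eigen[OF assms(2)]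
  have m: "0 < m" using assms(2) by simp
  have "(\<Sum>j<m. w j * (c \<cdot>\<^sub>m (B * R_pow m r)) $$ (j, 0)) =
        c * (\<Sum>j<m. w j * (B * R_pow m r) $$ (j, 0))"
    unfolding sum_distrib_left using assms(1) R(1)[of r] m
    by (intro sum.cong) (auto simp del: index_mult_mat(1))
  also have "(\<Sum>j<m. w j * (B * R_pow m r) $$ (j, 0)) = (\<Sum>i<m. d * mu m t ^ Suc i * R_pow m r $$ (i, 0))"
    unfolding left_sum_mult[OF assms(1) R(1) m] by (intro sum.cong) (auto simp: row simp del: power_Suc)
  also have "\<dots> = d * (\<Sum>i<m. mu m t ^ Suc i * R_pow m r $$ (i, 0))"
    by (simp add: sum_distrib_left mult.assoc)
  also have "(\<Sum>i<m. mu m t ^ Suc i * R_pow m r $$ (i, 0)) = mu m t powi (-r) * mu m t ^ Suc 0"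
    using R(2)[OF mu_root[OF assms(3)] mu_nz[OF assms(3)], of r] m unfolding left_eigen_def by blast
  also have "\<dots> = mu m t powi (1 - r)"
    using mu_nz[OF assms(3)] power_int_add[of "mu m t" "-r" 1] by (simp add: add.commute)
  finally show ?thesis .
qed

lemma F_seq_trig:
  assumes "j < m"
  shows "F_seq m (Suc j) r =
    (\<Sum>t=1..m. mu m t powi (1 - r) * (sin (real (2*j+1) * theta m t) / sin (theta m t)))"
proof -
  have "F_seq m (Suc j) r = (\<Sum>t=1..m. 2 * sin (real (2*j+1) * theta m t) *
          (mu m t powi (1 - r) / (2 * sin (theta m t))))"
  proof (rule dual_inversion[where x = "\<lambda>k. F_seq m (Suc k) r" and w = "\<lambda>k t. 2 * sin (real (2*k+1) * theta m t)"
          and c = "real (2*m+1)" and m = m])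
    show "(\<Sum>k<m. 2 * sin (real (2*k+1) * theta m t) * F_seq m (Suc k) r) =
         real (2*m+1) * (mu m t powi (1 - r) / (2 * sin (theta m t)))" if t: "t \<in> {1..m}" for t
    proof -
      have "(\<Sum>j<m. 2 * sin (real (2*j+1) * theta m t) * B_odd m $$ (j, i)) =
          (1 / (2 * sin (theta m t))) * mu m t ^ Suc i" if "i < m" for i
        using B_odd_dual[OF that, of "theta m t"] sin_theta_pos[OF t]
        by (simp add: mu_theta field_simps del: power_Suc)
      from row_R_pow[OF _ _ t this, where c = "real (2*m+1)" and r = r] show ?thesis
        using assms by (simp add: F_seq_def B_odd_def mat1_def)
    qed
  qed (use assms sin_orthogonality[OF assms] in auto)
  thus ?thesis by (simp add: field_simps)
qed

lemma G_seq_trig: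
  assumes "j < m"
  shows "G_seq m (Suc j) r =
    (\<Sum>t=1..m. mu m t powi (1 - r) * (2 * cos (real (2 * Suc j) * theta m t)))"
proof -
  have "G_seq m (Suc j) r = (\<Sum>t=1..m. 2 * cos (real (2*(j+1)) * theta m t) * mu m t powi (1 - r))"
  proof (rule dual_inversion[where x = "\<lambda>k. G_seq m (Suc k) r" and w = "\<lambda>k t. 2 * cos (real (2*(k+1)) * theta m t) - 2"
          and c = "real (2*m+1)" and m = m])
    show "(\<Sum>k<m. (2 * cos (real (2*(k+1)) * theta m t) - 2) * G_seq m (Suc k) r) =
         real (2*m+1) * mu m t powi (1 - r)" if t: "t \<in> {1..m}" for t
    proof -
      have "(\<Sum>j<m. (2 * cos (real (2*(j+1)) * theta m t) - 2) * B_even m $$ (j, i)) =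
          1 * mu m t ^ Suc i" if "i < m" for i
        using B_even_dual[OF that, of "theta m t"] by (simp add: mu_theta del: power_Suc)
      from row_R_pow[OF _ _ t this, where c = "real (2*m+1)" and r = r] show ?thesis
        using assms by (simp add: G_seq_def B_even_def mat1_def)
    qed
  qed (use assms cos_biorthogonality[OF assms] in auto)
  thus ?thesis by (simp add: mult.commute)
qed

section \<open>The equivalent forms of the sums\<close>

lemma P_poly_mu:
  assumes "t \<in> {1..m}"
  shows "poly (P_poly i) (mu m t) = sin (real (2*i+1) * theta m t) / sin (theta m t)"
  using poly_P_poly_sin[of i "theta m t"] sin_theta_pos[OF assms] by (simp add: mu_theta field_simps)

lemma Q_poly_mu:
  assumes "t \<in> {1..m}" "j \<ge> 1"
  shows "poly (Q_poly j) (mu m t) = 2 * cos (real (2*j) * theta m t)"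
  unfolding mu_theta using sin_theta_pos[OF assms(1)] assms(2) by (intro poly_Q_poly_cos) auto

text \<open>Since \<open>(2n+3)\<theta>\<close> is a multiple of \<open>pi\<close>, the angle \<open>(2n+1)\<theta>\<close> differs
from \<open>-2\<theta>\<close> by that multiple.\<close>
lemma P_poly_pred_mu:
  assumes "t \<in> {1..Suc n}"
  shows "poly (P_poly n) (mu (Suc n) t) = - (2 * (-1) ^ t * cos (theta (Suc n) t))"
proof -
  let ?\<theta> = "theta (Suc n) t"
  have e: "real (2*n+1) * ?\<theta> = real t * pi - 2 * ?\<theta>"
    using theta_full[of "Suc n" t] by (simp add: algebra_simps)
  have "sin (real (2*n+1) * ?\<theta>) = - ((-1) ^ t * sin (2 * ?\<theta>))"
    unfolding e sin_diff by simp
  thus ?thesis unfolding P_poly_mu[OF assms] sin_double using sin_theta_pos[OF assms] by simp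
qed

lemma Q_poly_last_mu:
  assumes "t \<in> {1..Suc n}"
  shows "poly (Q_poly (Suc n)) (mu (Suc n) t) = - poly (P_poly n) (mu (Suc n) t)"
  using mu_root[OF assms] by (simp add: Q_poly_Suc)

text \<open>With \<open>D\<close> the derivative of the polynomial \<open>P_poly (n+1)\<close> at its root, the left side is
\<open>8 (-1)^t sin\<^sup>2 \<theta> cos \<theta> * D\<close>, and \<open>P_poly_deriv_trig\<close> evaluates \<open>8 sin\<^sup>2 \<theta> cos \<theta> * D\<close>.\<close>
lemma P_poly_pred_deriv:
  assumes "t \<in> {1..Suc n}"
  shows "mu (Suc n) t * poly (P_poly n) (mu (Suc n) t) *
           (\<Prod>j\<in>{1..Suc n} - {t}. mu (Suc n) t - mu (Suc n) j) = - real (2 * Suc n + 1)"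
proof -
  let ?\<theta> = "theta (Suc n) t"
  define D where "D = poly (pderiv (P_poly (Suc n))) (mu (Suc n) t)"
  have "D * (- (4 * sin (2 * ?\<theta>))) * sin ?\<theta> = real (2 * Suc n + 1) * (-1) ^ t"
    using P_poly_deriv_trig[of "Suc n" ?\<theta>] sin_theta_pos[OF assms]
    unfolding theta_full D_def mu_theta by (simp del: of_nat_add of_nat_mult)
  moreover have "mu (Suc n) t * poly (P_poly n) (mu (Suc n) t) * D =
      - ((-1) ^ t * (D * (- (4 * sin (2 * ?\<theta>))) * sin ?\<theta>))"
    unfolding P_poly_pred_mu[OF assms] unfolding mu_theta chord_sq sin_double
    by (simp add: power2_eq_square)
  ultimately have "mu (Suc n) t * poly (P_poly n) (mu (Suc n) t) * D =
      - (((-1) ^ t * (-1) ^ t) * real (2 * Suc n + 1))"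
    by (simp only: mult_ac)
  thus ?thesis unfolding D_def P_poly_deriv_prod[OF assms] by (simp flip: power_mult_distrib)
qed

lemma power_int_neg_square:
  fixes s :: real
  assumes "s \<noteq> 0"
  shows "(- s\<^sup>2) powi (1 - r) = (-1) powi (r - 1) / s powi (2 * r - 2)"
proof -
  have "(- s\<^sup>2) powi (1 - r) = (-1) powi (1 - r) * (s\<^sup>2) powi (1 - r)"
    by (simp flip: power_int_mult_distrib)
  also have "(-1 :: real) powi (1 - r) = (-1) powi (r - 1)"
    using power_int_minus[of "-1::real" "r - 1"] power_int_inverse[of "-1::real" "r - 1"] by simp
  also have "(s\<^sup>2) powi (1 - r) = inverse (s powi (2 * r - 2))"
  proof -
    have "(s\<^sup>2) powi (1 - r) = s powi (2 * (1 - r))"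
      using power_int_mult[of s 2 "1 - r"] by simp
    also have "2 * (1 - r) = - (2 * r - 2)" by simp
    finally show ?thesis by (simp only: power_int_minus)
  qed
  finally show ?thesis by (simp add: divide_inverse)
qed

lemma mu_powi:
  assumes "t \<in> {1..m}"
  shows "mu m t powi (1 - r) = (-1) powi (r - 1) / (2 * sin (theta m t)) powi (2 * r - 2)"
  unfolding mu_theta chord_sq using sin_theta_pos[OF assms] by (intro power_int_neg_square) auto

theorem mainTheorem4:
  fixes m :: nat and \<nu> :: "nat \<Rightarrow> nat \<Rightarrow> complex"
  assumes "m \<ge> 1"
    and \<nu>_roots: "\<And>j. j \<ge> 1 \<Longrightarrow>
           proots (Q_poly j :: complex poly) = image_mset (\<nu> j) (mset_set {1..j})"
  shows
    "proots (P_poly m :: real poly) = image_mset (mu m) (mset_set {1..m}) \<and>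
     (\<forall>r::int.
       F_seq m m r = - G_seq m m r \<and>
       F_seq m m r =
         - (\<Sum>k=1..m. real (2*m+1) / (mu m k powi r * (\<Prod>j\<in>{1..m} - {k}. mu m k - mu m j))) \<and>
       F_seq m m r =
         - real (2*m+1) * (\<Sum>k=1..m. (2 * cos (2 * pi * real k / real (2*m+1)) - 2) powi (- r) *
             (\<Prod>j\<in>{1..m} - {k}. inverse (2 * cos (2 * pi * real k / real (2*m+1))
                                    - 2 * cos (2 * pi * real j / real (2*m+1))))) \<and>
       F_seq m 1 r = (\<Sum>k=1..m. mu m k powi (1 - r)) \<and>
       F_seq m 1 r = (\<Sum>k=1..m. (2 * cos (2 * pi * real k / real (2*m+1)) - 2) powi (1 - r)) \<and>
       (\<forall>j\<in>{1..m}.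
         F_seq m j r = (\<Sum>t=1..m. mu m t powi (1 - r) * poly (P_poly (j-1)) (mu m t)) \<and>
         F_seq m j r =
           (\<Sum>t=1..m. mu m t powi (1 - r) * (\<Prod>k=1..j-1. mu m t - mu (j-1) k)) \<and>
         F_seq m j r =
           (\<Sum>t=1..m. mu m t powi (1 - r) * (\<Prod>k=1..j-1. phi m t - phi (j-1) k)) \<and>
         F_seq m j r =
           (\<Sum>t=1..m. mu m t powi (1 - r) *
              S_cheb (2*j-2) (2 * cos (pi * real t / real (2*m+1)))) \<and>
         F_seq m j r =
           (-1) powi (r - 1) *
           (\<Sum>t=1..m. 2 * sin (real (2*j-1) * pi * real t / real (2*m+1)) /
              (2 * sin (pi * real t / real (2*m+1))) powi (2*r - 1)) \<and>
         F_seq m j r = (\<Sum>t=1..m. mu m t powi (1 - r) * poly (V_poly (j-1)) (phi m t)) \<and>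
         G_seq m j r = (\<Sum>t=1..m. mu m t powi (1 - r) * poly (Q_poly j) (mu m t)) \<and>
         complex_of_real (G_seq m j r) =
           (\<Sum>t=1..m. complex_of_real (mu m t powi (1 - r)) *
              (\<Prod>k=1..j. complex_of_real (mu m t) - \<nu> j k)) \<and>
         G_seq m j r =
           (\<Sum>t=1..m. mu m t powi (1 - r) *
              C_cheb (2*j) (2 * cos (pi * real t / real (2*m+1)))) \<and>
         G_seq m j r =
           (-1) powi (r - 1) *
           (\<Sum>t=1..m. 2 * cos (real (2*j) * pi * real t / real (2*m+1)) /
              (2 * sin (pi * real t / real (2*m+1))) powi (2*r - 2))))"
proof (intro conjI allI ballI)
  show "proots (P_poly m :: real poly) = image_mset (mu m) (mset_set {1..m})"
    by (rule proots_P_poly)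
next
  fix r :: int
  have F: "F_seq m (Suc i) r = (\<Sum>t=1..m. mu m t powi (1 - r) * poly (P_poly i) (mu m t))"
    if "i < m" for i
    unfolding F_seq_trig[OF that] by (intro sum.cong refl) (simp only: P_poly_mu)
  have G: "G_seq m (Suc i) r = (\<Sum>t=1..m. mu m t powi (1 - r) * poly (Q_poly (Suc i)) (mu m t))"
    if "i < m" for i
    unfolding G_seq_trig[OF that] by (intro sum.cong refl) (simp add: Q_poly_mu)
  obtain n where n: "m = Suc n" using assms(1) by (cases m) auto
  show "F_seq m m r = - G_seq m m r"
    using F[of n] G[of n] by (simp add: n Q_poly_last_mu flip: sum_negf)
  have Fm: "F_seq m m r = (\<Sum>k=1..m. - (real (2*m+1) / (mu m k powi r * (\<Prod>j\<in>{1..m} - {k}. mu m k - mu m j))))"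
  proof -
    have summand: "mu m k powi (1 - r) * poly (P_poly n) (mu m k) =
        - (real (2*m+1) / (mu m k powi r * (\<Prod>j\<in>{1..m} - {k}. mu m k - mu m j)))" if k: "k \<in> {1..m}" for k
    proof -
      let ?D = "\<Prod>j\<in>{1..m} - {k}. mu m k - mu m j"
      have nz: "mu m k \<noteq> 0" using k by (rule mu_nz)
      have *: "mu m k * poly (P_poly n) (mu m k) * ?D = - real (2*m+1)"
        using P_poly_pred_deriv[of k n] k unfolding n .
      have D: "?D \<noteq> 0"
      proof
        assume "?D = 0"
        with * have "real (2*m+1) = 0" by (simp only: mult_zero_right)
        thus False by simp
      qed
      have "mu m k powi (1 - r) * poly (P_poly n) (mu m k) = (mu m k * poly (P_poly n) (mu m k)) / mu m k powi r"
        using nz by (simp add: power_int_diff)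
      also have "mu m k * poly (P_poly n) (mu m k) = - real (2*m+1) / ?D"
        using * D by (metis nonzero_mult_div_cancel_right)
      finally show ?thesis
        by (simp only: divide_divide_eq_left minus_divide_left mult.commute)
    qed
    have "F_seq m m r = (\<Sum>k=1..m. mu m k powi (1 - r) * poly (P_poly n) (mu m k))"
      using F[of n] by (simp only: n lessI)
    also have "\<dots> = (\<Sum>k=1..m. - (real (2*m+1) / (mu m k powi r * (\<Prod>j\<in>{1..m} - {k}. mu m k - mu m j))))"
      by (rule sum.cong[OF refl summand])
    finally show ?thesis .
  qed
  show eq: "F_seq m m r =
         - (\<Sum>k=1..m. real (2*m+1) / (mu m k powi r * (\<Prod>j\<in>{1..m} - {k}. mu m k - mu m j)))"
    unfolding Fm by (simp only: sum_negf)
  show "F_seq m m r =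
         - real (2*m+1) * (\<Sum>k=1..m. (2 * cos (2 * pi * real k / real (2*m+1)) - 2) powi (- r) *
             (\<Prod>j\<in>{1..m} - {k}. inverse (2 * cos (2 * pi * real k / real (2*m+1))
                                    - 2 * cos (2 * pi * real j / real (2*m+1)))))"
  proof -
    have "(\<Sum>k=1..m. real (2*m+1) / (mu m k powi r * (\<Prod>j\<in>{1..m} - {k}. mu m k - mu m j))) =
        real (2*m+1) * (\<Sum>k=1..m. mu m k powi (- r) * (\<Prod>j\<in>{1..m} - {k}. inverse (mu m k - mu m j)))"
      unfolding sum_distrib_left
      by (intro sum.cong refl)
        (simp only: power_int_minus divide_inverse inverse_mult_distrib prod_inversef[symmetric] o_def)
    thus ?thesis unfolding eq mult_minus_left by (simp add: mu_def)
  qed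
  show F1: "F_seq m 1 r = (\<Sum>k=1..m. mu m k powi (1 - r))"
    using F[of 0] n by (simp add: P_poly_0)
  show "F_seq m 1 r = (\<Sum>k=1..m. (2 * cos (2 * pi * real k / real (2*m+1)) - 2) powi (1 - r))"
    unfolding F1 mu_def ..
  fix j assume j: "j \<in> {1..m}"
  then obtain i where i: "j = Suc i" "i < m" by (cases j) auto
  show P: "F_seq m j r = (\<Sum>t=1..m. mu m t powi (1 - r) * poly (P_poly (j-1)) (mu m t))"
    using F[OF i(2)] by (simp add: i)
  show prod: "F_seq m j r = (\<Sum>t=1..m. mu m t powi (1 - r) * (\<Prod>k=1..j-1. mu m t - mu (j-1) k))"
    unfolding P poly_P_poly_prod ..
  show "F_seq m j r = (\<Sum>t=1..m. mu m t powi (1 - r) * (\<Prod>k=1..j-1. phi m t - phi (j-1) k))"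
    unfolding prod by (simp add: mu_def phi_def)
  show "F_seq m j r = (\<Sum>t=1..m. mu m t powi (1 - r) *
              S_cheb (2*j-2) (2 * cos (pi * real t / real (2*m+1))))"
    unfolding P
  proof (intro sum.cong refl arg_cong2[where f = "(*)"])
    fix t assume t: "t \<in> {1..m}"
    have "poly (cheb_U (2*i)) (cos (theta m t)) = sin (real (2*i+1) * theta m t) / sin (theta m t)"
      using cheb_U_sin[of "2*i" "theta m t"] sin_theta_pos[OF t] by (simp add: field_simps)
    thus "poly (P_poly (j-1)) (mu m t) = S_cheb (2*j-2) (2 * cos (pi * real t / real (2*m+1)))"
      unfolding S_cheb_def theta_def[symmetric] by (simp add: i P_poly_mu[OF t])
  qed
  show "F_seq m j r = (-1) powi (r - 1) *
           (\<Sum>t=1..m. 2 * sin (real (2*j-1) * pi * real t / real (2*m+1)) /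
              (2 * sin (pi * real t / real (2*m+1))) powi (2*r - 1))"
    unfolding P sum_distrib_left
  proof (intro sum.cong refl)
    fix t assume t: "t \<in> {1..m}"
    define s where "s = 2 * sin (theta m t)"
    have s: "s \<noteq> 0" using sin_theta_pos[OF t] by (simp add: s_def)
    have p: "s powi (2 * r - 1) = s powi (2 * r - 2) * s"
      using power_int_add_1[of s "2 * r - 2"] s by simp
    have e: "real (2*j-1) * pi * real t / real (2*m+1) = real (2*i+1) * theta m t"
      by (simp add: i theta_def)
    have "poly (P_poly (j-1)) (mu m t) = 2 * sin (real (2*i+1) * theta m t) / s"
      by (simp add: i P_poly_mu[OF t] s_def)
    thus "mu m t powi (1 - r) * poly (P_poly (j-1)) (mu m t) = (-1) powi (r - 1) *
           (2 * sin (real (2*j-1) * pi * real t / real (2*m+1)) /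
              (2 * sin (pi * real t / real (2*m+1))) powi (2*r - 1))"
      unfolding mu_powi[OF t] e theta_def[symmetric] s_def[symmetric] p by simp
  qed
  show "F_seq m j r = (\<Sum>t=1..m. mu m t powi (1 - r) * poly (V_poly (j-1)) (phi m t))"
    unfolding P poly_V_poly by (simp add: mu_def phi_def)
  show Q: "G_seq m j r = (\<Sum>t=1..m. mu m t powi (1 - r) * poly (Q_poly j) (mu m t))"
    using G[OF i(2)] by (simp add: i)
  show "complex_of_real (G_seq m j r) =
           (\<Sum>t=1..m. complex_of_real (mu m t powi (1 - r)) *
              (\<Prod>k=1..j. complex_of_real (mu m t) - \<nu> j k))"
  proof -
    have j1: "j \<ge> 1" using j by simp
    show ?thesis
      unfolding Q Q_poly_complex_prod[OF j1 \<nu>_roots[OF j1], symmetric] poly_Q_poly_of_real by simp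
  qed
  have Q_cos: "poly (Q_poly j) (mu m t) = 2 * cos (real (2*j) * theta m t)" if "t \<in> {1..m}" for t
    using Q_poly_mu[OF that] j by simp
  show "G_seq m j r = (\<Sum>t=1..m. mu m t powi (1 - r) *
              C_cheb (2*j) (2 * cos (pi * real t / real (2*m+1))))"
    unfolding Q C_cheb_def theta_def[symmetric]
    by (intro sum.cong refl) (simp add: Q_cos cheb_T_cos)
  show "G_seq m j r = (-1) powi (r - 1) *
           (\<Sum>t=1..m. 2 * cos (real (2*j) * pi * real t / real (2*m+1)) /
              (2 * sin (pi * real t / real (2*m+1))) powi (2*r - 2))"
    unfolding Q sum_distrib_left
  proof (intro sum.cong refl)
    fix t assume t: "t \<in> {1..m}"
    have e: "real (2*j) * pi * real t / real (2*m+1) = real (2*j) * theta m t"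
      by (simp add: theta_def)
    show "mu m t powi (1 - r) * poly (Q_poly j) (mu m t) = (-1) powi (r - 1) *
           (2 * cos (real (2*j) * pi * real t / real (2*m+1)) /
              (2 * sin (pi * real t / real (2*m+1))) powi (2*r - 2))"
      unfolding mu_powi[OF t] Q_cos[OF t] e theta_def[symmetric] by simp
  qed
qed

end
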